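(* Let $\Pi=\{\pi_1,\pi_2,\ldots,\pi_K\}$ be a finite set of integer partitions with $\pi_1=\emptyset$ (the empty partition), equipped with linking sets $\mathcal{L}(\pi_k)\subseteq\Pi$ such that $\emptyset\in\mathcal{L}(\pi_k)$ for every $k$ and $\mathcal{L}(\emptyset)=\Pi$, and let $S$ be a positive integer no smaller than the largest part among all partitions in $\Pi$. Let $\mathscr{I}=\mathscr{I}(\langle\Pi,\mathcal{L}\rangle,S)$ be the associated span one linked partition ideal. For each $1\le k\le K$, let $\mathscr{I}_k$ be the set of partitions $\lambda\in\mathscr{I}$ whose $S$-tail is $\pi_k$, and put $$\mathscr{G}_k(x)=\mathscr{G}_k(x,q):=\sum_{\lambda\in\mathscr{I}_k}x^{\sharp(\lambda)}q^{|\lambda|}.$$ Let $\mathscr{A}$ be the $K\times K$ $(0,1)$-matrix with $\mathscr{A}_{i,j}=1$ if $\pi_j\in\mathcal{L}(\pi_i)$ and $\mathscr{A}_{i,j}=0$ otherwise, and let $\mathscr{W}(x)=\operatorname{diag}\big(x^{\sharp(\pi_1)}q^{|\pi_1|},\ldots,x^{\sharp(\pi_K)}q^{|\pi_K|}\big)$. Then, for $|q|<1$ and $|x|<|q|^{-1}$, $$\begin{pmatrix}\mathscr{G}_1(x)\\ \vdots\\ \mathscr{G}_K(x)\end{pmatrix}=\mathscr{W}(x)\cdot\left(\lim_{M\to\infty}\mathscr{A}\,\mathscr{W}(xq^{S})\,\mathscr{A}\,\mathscr{W}(xq^{2S})\cdots\mathscr{A}\,\mathscr{W}(xq^{MS})\right)\cdot\begin{pmatrix}1\\0\\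 \vdots\\0\end{pmatrix}.$$
   Context: For a partition $\lambda$, $\sharp(\lambda)$ is its number of parts and $|\lambda|$ its size (sum of parts). The map $\phi$ sends a partition to the partition obtained by adding $1$ to each of its parts, and $\phi^k$ denotes its $k$-fold iterate. For partitions $\lambda,\pi$, $\lambda\oplus\pi$ is the partition in which each integer appears as a part as many times as the total number of its appearances in $\lambda$ and in $\pi$. The span one linked partition ideal $\mathscr{I}(\langle\Pi,\mathcal{L}\rangle,S)$ is the set consisting of the empty partition together with all partitions of the form $\lambda_0\oplus\phi^{S}(\lambda_1)\oplus\phi^{2S}(\lambda_2)\oplus\cdots\oplus\phi^{KS}(\lambda_K)$ arising from finite chains $\lambda_0\to\lambda_1\to\cdots\to\lambda_K$ with $\lambda_0\in\Pi$, $\lambda_K\neq\emptyset$ and $\lambda_k\in\mathcal{L}(\lambda_{k-1})$ for $1\le k\le K$ (such a decomposition is unique). The $S$-tail of a partition $\lambda$ is the collection of parts of $\lambda$ that are $\le S$. *)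

theory Defs
  imports "HOL-Analysis.Analysis" "HOL-Library.Multiset"
begin

text \<open>An integer partition is encoded as the multiset of its parts, so the number of parts of \<open>\<mu>\<close> is \<^term>\<open>size \<mu>\<close>,
  its size is \<^term>\<open>sum_mset \<mu>\<close>, the empty partition is \<^term>\<open>{#}\<close>, and \<open>\<oplus>\<close> is multiset addition.\<close>

definition is_partition :: "nat multiset \<Rightarrow> bool" where
  "is_partition \<mu> \<longleftrightarrow> (\<forall>p \<in># \<mu>. 1 \<le> p)"

definition phi :: "nat multiset \<Rightarrow> nat multiset" where
  "phi \<mu> = image_mset (\<lambda>p. p + 1) \<mu>"

definition span_one_ideal ::
  "nat multiset set \<Rightarrow> (nat multiset \<Rightarrow> nat multiset set) \<Rightarrow> nat \<Rightarrow> nat multiset set" where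
  "span_one_ideal P L S =
     insert {#}
       {(\<Sum>k\<le>N. (phi ^^ (k * S)) (c k)) | c N.
          c 0 \<in> P \<and> c N \<noteq> {#} \<and> (\<forall>k\<in>{1..N}. c k \<in> L (c (k - 1)))}"

definition tail :: "nat \<Rightarrow> nat multiset \<Rightarrow> nat multiset" where
  "tail S \<mu> = filter_mset (\<lambda>p. p \<le> S) \<mu>"

definition ideal_with_tail ::
  "nat multiset set \<Rightarrow> (nat multiset \<Rightarrow> nat multiset set) \<Rightarrow> nat \<Rightarrow> nat multiset
    \<Rightarrow> nat multiset set" where
  "ideal_with_tail P L S \<pi> = {\<mu> \<in> span_one_ideal P L S. tail S \<mu> = \<pi>}"

definition weight :: "complex \<Rightarrow> complex \<Rightarrow> nat multiset \<Rightarrow> complex" where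
  "weight q x \<mu> = x ^ size \<mu> * q ^ sum_mset \<mu>"

definition gen_fun :: "nat multiset set \<Rightarrow> complex \<Rightarrow> complex \<Rightarrow> complex" where
  "gen_fun I q x = (\<Sum>\<^sub>\<infinity>\<mu>\<in>I. weight q x \<mu>)"

text \<open>The enumeration \<open>\<pi>\<^sub>1, \<dots>, \<pi>\<^sub>K\<close> is a function on a finite index type with \<open>K\<close> elements.\<close>

definition link_matrix ::
  "('k::finite \<Rightarrow> nat multiset) \<Rightarrow> (nat multiset \<Rightarrow> nat multiset set) \<Rightarrow> complex ^ 'k ^ 'k" where
  "link_matrix \<pi> L = (\<chi> i j. if \<pi> j \<in> L (\<pi> i) then 1 else 0)"

definition weight_matrix ::
  "('k::finite \<Rightarrow> nat multiset) \<Rightarrow> complex \<Rightarrow> complex \<Rightarrow> complex ^ 'k ^ 'k" where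
  "weight_matrix \<pi> q x = (\<chi> i j. if i = j then weight q x (\<pi> i) else 0)"

primrec link_product ::
  "('k::finite \<Rightarrow> nat multiset) \<Rightarrow> (nat multiset \<Rightarrow> nat multiset set) \<Rightarrow> nat
    \<Rightarrow> complex \<Rightarrow> complex \<Rightarrow> nat \<Rightarrow> complex ^ 'k ^ 'k" where
  "link_product \<pi> L S q x 0 = mat 1"
| "link_product \<pi> L S q x (Suc M) =
     link_product \<pi> L S q x M ** (link_matrix \<pi> L ** weight_matrix \<pi> q (x * q ^ (Suc M * S)))"

end

theory Submission
  imports Defs
begin

text \<open>
  On \<open>\<bar>q\<bar> < 1\<close>, \<open>\<bar>xq\<bar> < 1\<close> the weights are absolutely summable over all partitions, because the
  Euler product \<open>\<Prod>\<^sub>p 1 / (1 - \<bar>x\<bar>\<bar>q\<bar>\<^sup>p)\<close> converges. The partitions in the ideal with tail \<open>\<pi>\<^sub>k\<close>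
  are exhausted by the sums of chains with \<open>M\<close> links starting at \<open>\<pi>\<^sub>k\<close>; splitting off the first
  partition of a chain and letting \<open>M \<rightarrow> \<infinity>\<close> gives \<open>G(x) = W(x) A G(xq\<^sup>S)\<close> for the vector \<open>G\<close> of
  generating functions.

  Let \<open>R\<^sub>M(x)\<close> be the \<open>M\<close>-fold product, \<open>e\<close> the unit vector of \<open>\<pi>\<^sub>1 = \<emptyset>\<close> and \<open>u\<close> the all-ones
  vector. Then \<open>W(x) R\<^sub>M(x) u\<close> is the generating vector of the chains with \<open>M\<close> links, and
  \<open>R\<^bsub>M+1\<^esub>(x) e = R\<^sub>M(x) u\<close> because \<open>\<emptyset>\<close> has weight \<open>1\<close> and may follow every partition. Hence
  \<open>R\<^sub>M(x) e \<rightarrow> A G(xq\<^sup>S)\<close> and \<open>R\<^sub>M(x) u - R\<^sub>M(x) e \<rightarrow> 0\<close>. For nonnegative \<open>q\<close> and \<open>x\<close> the latter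
  forces every other column of \<open>R\<^sub>M(x)\<close> to vanish in the limit; in general these columns are
  dominated by those at \<open>\<bar>q\<bar>\<close>, \<open>\<bar>x\<bar>\<close>.
\<close>

section \<open>Summation over multisets and increasing unions\<close>

lemma bij_betw_mset_insert:
  assumes "a \<notin> A"
  shows "bij_betw (\<lambda>(\<mu>, n). \<mu> + replicate_mset n a)
    ({\<mu>. set_mset \<mu> \<subseteq> A} \<times> UNIV) {\<mu>. set_mset \<mu> \<subseteq> insert a A}"
proof (rule bij_betw_byWitness[where f' = "\<lambda>\<kappa>. (filter_mset (\<lambda>b. b \<noteq> a) \<kappa>, count \<kappa> a)"])
  have "filter_mset (\<lambda>b. b \<noteq> a) \<mu> = \<mu>" "count \<mu> a = 0" if "set_mset \<mu> \<subseteq> A" for \<mu>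
    using that assms by (auto simp: filter_mset_eq_conv count_eq_zero_iff)
  moreover have "filter_mset (\<lambda>b. b \<noteq> a) (replicate_mset n a) = {#}" for n
    by (simp add: filter_mset_eq_conv)
  ultimately show "\<forall>p\<in>{\<mu>. set_mset \<mu> \<subseteq> A} \<times> UNIV.
      (\<lambda>\<kappa>. (filter_mset (\<lambda>b. b \<noteq> a) \<kappa>, count \<kappa> a)) ((\<lambda>(\<mu>, n). \<mu> + replicate_mset n a) p) = p"
    by auto
qed (auto simp: multiset_eq_iff split: if_splits)

lemma prod_mset_image_nonneg:
  fixes f :: "'a \<Rightarrow> 'b::linordered_idom"
  assumes "\<And>a. a \<in># \<mu> \<Longrightarrow> 0 \<le> f a"
  shows "0 \<le> (\<Prod>a\<in>#\<mu>. f a)"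
  using assms by (induction \<mu>) auto

lemma has_sum_prod_mset:
  fixes r :: "'a \<Rightarrow> real"
  assumes "finite A" "\<And>a. a \<in> A \<Longrightarrow> 0 \<le> r a" "\<And>a. a \<in> A \<Longrightarrow> r a < 1"
  shows "((\<lambda>\<mu>. \<Prod>a\<in>#\<mu>. r a) has_sum (\<Prod>a\<in>A. 1 / (1 - r a))) {\<mu>. set_mset \<mu> \<subseteq> A}"
  using assms
proof (induction A rule: finite_induct)
  case empty
  show ?case
    using has_sum_finite[of "{{#}}" "\<lambda>\<mu>. \<Prod>a\<in>#\<mu>. r a"] by simp
next
  case (insert a A)
  let ?M = "{\<mu>. set_mset \<mu> \<subseteq> A}" and ?f = "\<lambda>\<mu>. \<Prod>b\<in>#\<mu>. r b"
  have geometric: "((\<lambda>n. r a ^ n) has_sum 1 / (1 - r a)) UNIV"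
    using insert.prems by (intro sums_nonneg_imp_has_sum geometric_sums) auto
  have fibre: "((\<lambda>n. ?f \<mu> * r a ^ n) has_sum ?f \<mu> * (1 / (1 - r a))) UNIV" for \<mu>
    by (intro has_sum_cmult_right geometric)
  have base: "((\<lambda>\<mu>. ?f \<mu> * (1 / (1 - r a))) has_sum (\<Prod>b\<in>A. 1 / (1 - r b)) * (1 / (1 - r a))) ?M"
    by (intro has_sum_cmult_left insert.IH) (use insert.prems in auto)
  have "0 \<le> ?f \<mu>" if "set_mset \<mu> \<subseteq> A" for \<mu>
    using that insert.prems(1) by (intro prod_mset_image_nonneg) auto
  then have "(\<lambda>(\<mu>, n). ?f \<mu> * r a ^ n) summable_on ?M \<times> UNIV"
    by (intro summable_on_SigmaI[where g = "\<lambda>\<mu>. ?f \<mu> * (1 / (1 - r a))"])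
      (use fibre base[THEN has_sum_imp_summable] insert.prems(1) in auto)
  then have "((\<lambda>(\<mu>, n). ?f \<mu> * r a ^ n) has_sum (\<Prod>b\<in>A. 1 / (1 - r b)) * (1 / (1 - r a)))
      (?M \<times> UNIV)"
    by (intro has_sum_SigmaI[where g = "\<lambda>\<mu>. ?f \<mu> * (1 / (1 - r a))"]) (use fibre base in auto)
  also have "(\<lambda>(\<mu>, n). ?f \<mu> * r a ^ n) = (\<lambda>p. ?f (case p of (\<mu>, n) \<Rightarrow> \<mu> + replicate_mset n a))"
    by (auto simp: fun_eq_iff)
  finally show ?case
    using insert.hyps has_sum_reindex_bij_betw[OF bij_betw_mset_insert, of a A ?f]
    by (simp add: mult.commute)
qed

lemma prod_inverse_one_minus_le_exp:
  fixes r :: "'a \<Rightarrow> real"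
  assumes "finite A" "\<And>a. a \<in> A \<Longrightarrow> 0 \<le> r a" "\<And>a. a \<in> A \<Longrightarrow> r a \<le> \<rho>" "\<rho> < 1"
  shows "(\<Prod>a\<in>A. 1 / (1 - r a)) \<le> exp (sum r A / (1 - \<rho>))"
proof -
  have "(\<Prod>a\<in>A. 1 / (1 - r a)) \<le> (\<Prod>a\<in>A. exp (r a / (1 - \<rho>)))"
  proof (rule prod_mono, intro conjI)
    fix a assume "a \<in> A"
    then have a: "0 \<le> r a" "r a \<le> \<rho>" "0 < 1 - r a"
      using assms(2)[of a] assms(3)[of a] assms(4) by auto
    then show "0 \<le> 1 / (1 - r a)" by simp
    have "1 / (1 - r a) = 1 + r a / (1 - r a)"
      using a(3) by (simp add: divide_simps)
    also have "\<dots> \<le> 1 + r a / (1 - \<rho>)"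
      using a assms(4) by (intro add_left_mono divide_left_mono) auto
    also have "\<dots> \<le> exp (r a / (1 - \<rho>))"
      by (rule exp_ge_add_one_self)
    finally show "1 / (1 - r a) \<le> exp (r a / (1 - \<rho>))" .
  qed
  then show ?thesis
    by (simp add: exp_sum[symmetric] assms(1) sum_divide_distrib)
qed

lemma summable_on_prod_mset:
  fixes r :: "'a \<Rightarrow> real"
  assumes "\<And>a. a \<in> A \<Longrightarrow> 0 \<le> r a" "\<And>a. a \<in> A \<Longrightarrow> r a \<le> \<rho>" "\<rho> < 1" "r summable_on A"
  shows "(\<lambda>\<mu>. \<Prod>a\<in>#\<mu>. r a) summable_on {\<mu>. set_mset \<mu> \<subseteq> A}"
proof (rule nonneg_bdd_above_summable_on)
  show prod_nonneg: "0 \<le> (\<Prod>a\<in>#\<mu>. r a)" if "\<mu> \<in> {\<mu>. set_mset \<mu> \<subseteq> A}" for \<mu>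
    using that assms(1) by (intro prod_mset_image_nonneg) auto
  show "bdd_above (sum (\<lambda>\<mu>. \<Prod>a\<in>#\<mu>. r a) ` {F. F \<subseteq> {\<mu>. set_mset \<mu> \<subseteq> A} \<and> finite F})"
  proof (rule bdd_aboveI2)
    fix F assume "F \<in> {F. F \<subseteq> {\<mu>. set_mset \<mu> \<subseteq> A} \<and> finite F}"
    then have F: "finite F" "\<And>\<mu>. \<mu> \<in> F \<Longrightarrow> set_mset \<mu> \<subseteq> A" by auto
    define B where "B = (\<Union>\<mu>\<in>F. set_mset \<mu>)"
    have B: "finite B" "B \<subseteq> A" using F by (auto simp: B_def)
    have "(\<Sum>\<mu>\<in>F. \<Prod>a\<in>#\<mu>. r a) \<le> (\<Prod>a\<in>B. 1 / (1 - r a))"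
    proof (rule finite_sum_le_has_sum)
      show "((\<lambda>\<mu>. \<Prod>a\<in>#\<mu>. r a) has_sum (\<Prod>a\<in>B. 1 / (1 - r a))) {\<mu>. set_mset \<mu> \<subseteq> B}"
        using B assms(1-3) by (intro has_sum_prod_mset) force+
    qed (use B F prod_nonneg in \<open>auto simp: B_def\<close>)
    also have "\<dots> \<le> exp (sum r B / (1 - \<rho>))"
      using B assms(1-3) by (intro prod_inverse_one_minus_le_exp) auto
    also have "\<dots> \<le> exp (infsum r A / (1 - \<rho>))"
      using finite_sum_le_infsum[OF assms(4) B] assms(1,3)
      by (simp add: divide_right_mono)
    finally show "(\<Sum>\<mu>\<in>F. \<Prod>a\<in>#\<mu>. r a) \<le> exp (infsum r A / (1 - \<rho>))" .
  qed
qed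

lemma filterlim_incseq_finite_subsets_at_top:
  assumes "incseq A" "\<And>n. finite (A n)"
  shows "filterlim A (finite_subsets_at_top (\<Union>n. A n)) sequentially"
  unfolding filterlim_finite_subsets_at_top
proof (intro allI impI, elim conjE)
  fix F assume "finite F" "F \<subseteq> (\<Union>n. A n)"
  then have "\<exists>n. F \<subseteq> A n"
  proof (induction F rule: finite_induct)
    case (insert a F)
    then obtain m n where "a \<in> A m" "F \<subseteq> A n" by auto
    then have "insert a F \<subseteq> A (max m n)"
      using incseqD[OF assms(1), of m "max m n"] incseqD[OF assms(1), of n "max m n"] by auto
    then show ?case ..
  qed simp
  then obtain n where "F \<subseteq> A n" ..
  then have "F \<subseteq> A m" if "n \<le> m" for m
    using incseqD[OF assms(1) that] by blast
  then show "\<forall>\<^sub>F m in sequentially. finite (A m) \<and> F \<subseteq> A m \<and> A m \<subseteq> (\<Union>n. A n)"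
    using assms(2) unfolding eventually_sequentially by blast
qed

lemma has_sum_incseq_LIMSEQ:
  assumes "(f has_sum s) (\<Union>n. A n)" "incseq A" "\<And>n. finite (A n)"
  shows "(\<lambda>n. sum f (A n)) \<longlonglongrightarrow> s"
  using assms(1) filterlim_incseq_finite_subsets_at_top[OF assms(2,3)]
  unfolding has_sum_def by (rule filterlim_compose)


section \<open>Shifts and weights of partitions\<close>

lemma phi_funpow: "(phi ^^ n) \<mu> = image_mset (\<lambda>p. p + n) \<mu>"
  by (induction n) (auto simp: phi_def multiset.map_comp o_def)

lemma phi_funpow_sum: "(phi ^^ n) (\<Sum>i\<in>I. f i) = (\<Sum>i\<in>I. (phi ^^ n) (f i))"
  by (induction I rule: infinite_finite_induct) (auto simp: phi_funpow)

lemma inj_phi_funpow: "inj (phi ^^ n)"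
  unfolding phi_funpow[abs_def] by (intro multiset.inj_map inj_onI) simp

lemma is_partition_phi_funpow: "is_partition \<mu> \<Longrightarrow> is_partition ((phi ^^ n) \<mu>)"
  by (auto simp: is_partition_def phi_funpow)

lemma is_partition_add: "is_partition (\<mu> + \<nu>) \<longleftrightarrow> is_partition \<mu> \<and> is_partition \<nu>"
  by (auto simp: is_partition_def)

lemma tail_add_phi_funpow:
  assumes "\<And>p. p \<in># \<mu> \<Longrightarrow> p \<le> S" "is_partition \<nu>"
  shows "tail S (\<mu> + (phi ^^ S) \<nu>) = \<mu>"
proof -
  have "filter_mset (\<lambda>p. p \<le> S) \<mu> = \<mu>"
    using assms(1) by (simp add: filter_mset_eq_conv)
  moreover have "filter_mset (\<lambda>p. p \<le> S) ((phi ^^ S) \<nu>) = {#}"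
    using assms(2) by (auto simp: filter_mset_eq_conv is_partition_def phi_funpow)
  ultimately show ?thesis
    by (simp add: tail_def)
qed

lemma weight_eq_prod_mset: "weight q x \<mu> = (\<Prod>p\<in>#\<mu>. x * q ^ p)"
  by (induction \<mu>) (simp_all add: weight_def power_add mult_ac)

lemma weight_empty [simp]: "weight q x {#} = 1"
  by (simp add: weight_def)

lemma weight_add: "weight q x (\<mu> + \<nu>) = weight q x \<mu> * weight q x \<nu>"
  by (simp add: weight_eq_prod_mset)

lemma weight_phi_funpow: "weight q x ((phi ^^ n) \<mu>) = weight q (x * q ^ n) \<mu>"
  by (simp add: weight_eq_prod_mset phi_funpow multiset.map_comp o_def power_add mult_ac)

lemma weight_of_real_norm:
  "weight (of_real (norm q)) (of_real (norm x)) \<mu> = of_real (norm (weight q x \<mu>))"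
  by (simp add: weight_def norm_mult norm_power)

lemma norm_weight_summable_on_partitions:
  assumes "norm q < 1" "norm (x * q) < 1"
  shows "(\<lambda>\<mu>. norm (weight q x \<mu>)) summable_on {\<mu>. is_partition \<mu>}"
proof -
  define r where "r p = norm x * norm q ^ p" for p :: nat
  have norm_weight: "norm (weight q x \<mu>) = (\<Prod>p\<in>#\<mu>. r p)" for \<mu>
    unfolding weight_eq_prod_mset r_def by (induction \<mu>) (simp_all add: norm_mult norm_power)
  have "summable r"
    unfolding r_def using assms(1) by (intro summable_mult summable_geometric) simp
  moreover have r_nonneg: "0 \<le> r p" for p
    by (simp add: r_def)
  ultimately have "r summable_on {1..}"
    using summable_on_subset_banach[OF summable_nonneg_imp_summable_on] by blast
  moreover have "r p \<le> norm (x * q)" if "1 \<le> p" for p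
    using power_decreasing[of 1 p "norm q"] that assms(1)
    by (simp add: r_def norm_mult mult_left_mono)
  ultimately have "(\<lambda>\<mu>. \<Prod>p\<in>#\<mu>. r p) summable_on {\<mu>. set_mset \<mu> \<subseteq> {1..}}"
    using assms(2) by (intro summable_on_prod_mset) (auto simp: r_nonneg)
  then show ?thesis
    by (simp add: norm_weight is_partition_def subset_eq)
qed

lemma gen_fun_finite: "finite I \<Longrightarrow> gen_fun I q x = sum (weight q x) I"
  by (simp add: gen_fun_def)


section \<open>Truncated chains\<close>

definition chain_sums ::
  "(nat multiset \<Rightarrow> nat multiset set) \<Rightarrow> nat \<Rightarrow> nat \<Rightarrow> nat multiset \<Rightarrow> nat multiset set" where
  "chain_sums L S N \<mu> =
     {(\<Sum>k\<le>N. (phi ^^ (k * S)) (c k)) | c. c 0 = \<mu> \<and> (\<forall>k<N. c (Suc k) \<in> L (c k))}"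

lemma chain_sums_0 [simp]: "chain_sums L S 0 \<mu> = {\<mu>}"
  by (auto simp: chain_sums_def intro: exI[of _ "\<lambda>_. \<mu>"])

lemma chain_sums_Suc:
  "chain_sums L S (Suc N) \<mu> = (\<Union>\<nu>\<in>L \<mu>. (\<lambda>\<kappa>. \<mu> + (phi ^^ S) \<kappa>) ` chain_sums L S N \<nu>)"
proof -
  have split_first: "(\<Sum>k\<le>Suc N. (phi ^^ (k * S)) (c k)) =
      c 0 + (phi ^^ S) (\<Sum>k\<le>N. (phi ^^ (k * S)) (c (Suc k)))" for c
    unfolding sum.atMost_Suc_shift phi_funpow_sum by (simp add: funpow_add)
  show ?thesis
  proof (intro equalityI subsetI)
    fix \<kappa> assume "\<kappa> \<in> chain_sums L S (Suc N) \<mu>"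
    then obtain c where c: "\<kappa> = (\<Sum>k\<le>Suc N. (phi ^^ (k * S)) (c k))" "c 0 = \<mu>"
      "c 1 \<in> L \<mu>" "\<forall>k<N. c (Suc (Suc k)) \<in> L (c (Suc k))"
      by (auto simp: chain_sums_def All_less_Suc2)
    then have "(\<Sum>k\<le>N. (phi ^^ (k * S)) (c (Suc k))) \<in> chain_sums L S N (c 1)"
      unfolding chain_sums_def by auto
    then show "\<kappa> \<in> (\<Union>\<nu>\<in>L \<mu>. (\<lambda>\<kappa>. \<mu> + (phi ^^ S) \<kappa>) ` chain_sums L S N \<nu>)"
      using c(2,3) unfolding c(1) split_first by blast
  next
    fix \<kappa> assume "\<kappa> \<in> (\<Union>\<nu>\<in>L \<mu>. (\<lambda>\<kappa>. \<mu> + (phi ^^ S) \<kappa>) ` chain_sums L S N \<nu>)"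
    then obtain c where c: "\<kappa> = \<mu> + (phi ^^ S) (\<Sum>k\<le>N. (phi ^^ (k * S)) (c k))"
      "c 0 \<in> L \<mu>" "\<forall>k<N. c (Suc k) \<in> L (c k)"
      by (auto simp: chain_sums_def)
    then have "\<kappa> = (\<Sum>k\<le>Suc N. (phi ^^ (k * S)) (case_nat \<mu> c k))"
      unfolding split_first by simp
    moreover have "\<forall>k<Suc N. case_nat \<mu> c (Suc k) \<in> L (case_nat \<mu> c k)"
      using c(2,3) by (auto simp: All_less_Suc2)
    ultimately show "\<kappa> \<in> chain_sums L S (Suc N) \<mu>"
      unfolding chain_sums_def by (intro CollectI exI[of _ "case_nat \<mu> c"]) simp
  qed
qed

lemma chain_sums_subset_span_one_ideal:
  assumes "\<mu> \<in> P"
  shows "chain_sums L S N \<mu> \<subseteq> span_one_ideal P L S"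
proof (induction N)
  case 0
  show ?case
    proof (cases "\<mu> = {#}")
    case False
    then show ?thesis
      using assms unfolding span_one_ideal_def by (force intro: exI[of _ "\<lambda>_. \<mu>"] exI[of _ 0])
  qed (simp add: span_one_ideal_def)
next
  case (Suc N)
  show ?case
  proof
    fix \<kappa> assume "\<kappa> \<in> chain_sums L S (Suc N) \<mu>"
    then obtain c where \<kappa>: "\<kappa> = (\<Sum>k\<le>Suc N. (phi ^^ (k * S)) (c k))"
      and c: "c 0 = \<mu>" "\<forall>k<Suc N. c (Suc k) \<in> L (c k)"
      by (auto simp: chain_sums_def)
    show "\<kappa> \<in> span_one_ideal P L S"
    proof (cases "c (Suc N) = {#}")
      case True
      then have "\<kappa> \<in> chain_sums L S N \<mu>"
        using c by (auto simp: \<kappa> chain_sums_def phi_funpow)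
      with Suc.IH show ?thesis ..
    next
      case False
      moreover have "\<forall>k\<in>{1..Suc N}. c k \<in> L (c (k - 1))"
        using c(2) by (auto simp: gr0_conv_Suc Suc_le_eq)
      ultimately show ?thesis
        using assms c(1) \<kappa> unfolding span_one_ideal_def by blast
    qed
  qed
qed

lemma span_one_ideal_eq_UN_chain_sums:
  assumes "{#} \<in> P"
  shows "span_one_ideal P L S = (\<Union>\<mu>\<in>P. \<Union>N. chain_sums L S N \<mu>)"
proof
  show "span_one_ideal P L S \<subseteq> (\<Union>\<mu>\<in>P. \<Union>N. chain_sums L S N \<mu>)"
  proof
    fix \<kappa> assume "\<kappa> \<in> span_one_ideal P L S"
    then consider (empty) "\<kappa> = {#}" | (chain) c N where "c 0 \<in> P" "\<forall>k\<in>{1..N}. c k \<in> L (c (k - 1))"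
      "\<kappa> = (\<Sum>k\<le>N. (phi ^^ (k * S)) (c k))"
      unfolding span_one_ideal_def by blast
    then show "\<kappa> \<in> (\<Union>\<mu>\<in>P. \<Union>N. chain_sums L S N \<mu>)"
    proof cases
      case empty
      then have "\<kappa> \<in> chain_sums L S 0 {#}" by simp
      with assms show ?thesis by blast
    next
      case chain
      have "\<forall>k<N. c (Suc k) \<in> L (c k)"
        using chain(2)[rule_format, of "Suc _"] by auto
      then have "\<kappa> \<in> chain_sums L S N (c 0)"
        using chain(3) unfolding chain_sums_def by blast
      with chain(1) show ?thesis by blast
    qed
  qed
qed (use chain_sums_subset_span_one_ideal in blast)

locale linked_partitions =
  fixes P :: "nat multiset set"
    and L :: "nat multiset \<Rightarrow> nat multiset set"
    and S :: nat
  assumes finite_P: "finite P"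
    and empty_mem_P: "{#} \<in> P"
    and is_partition_P: "\<mu> \<in> P \<Longrightarrow> is_partition \<mu>"
    and parts_le: "\<mu> \<in> P \<Longrightarrow> p \<in># \<mu> \<Longrightarrow> p \<le> S"
    and L_subset: "\<mu> \<in> P \<Longrightarrow> L \<mu> \<subseteq> P"
    and empty_mem_L: "\<mu> \<in> P \<Longrightarrow> {#} \<in> L \<mu>"
begin

lemma finite_L: "\<mu> \<in> P \<Longrightarrow> finite (L \<mu>)"
  using L_subset finite_P by (rule finite_subset)

lemma finite_chain_sums: "\<mu> \<in> P \<Longrightarrow> finite (chain_sums L S N \<mu>)"
  by (induction N arbitrary: \<mu>) (auto simp: chain_sums_Suc finite_L dest: L_subset)

lemma is_partition_chain_sums: "\<mu> \<in> P \<Longrightarrow> \<kappa> \<in> chain_sums L S N \<mu> \<Longrightarrow> is_partition \<kappa>"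
proof (induction N arbitrary: \<mu> \<kappa>)
  case (Suc N)
  from Suc.prems(2) obtain \<nu> \<kappa>' where \<nu>: "\<nu> \<in> L \<mu>" "\<kappa>' \<in> chain_sums L S N \<nu>"
    and \<kappa>: "\<kappa> = \<mu> + (phi ^^ S) \<kappa>'"
    by (auto simp: chain_sums_Suc)
  have "is_partition \<kappa>'"
    using Suc.IH[OF _ \<nu>(2)] L_subset[OF Suc.prems(1)] \<nu>(1) by blast
  then show ?case
    using Suc.prems(1) by (simp add: \<kappa> is_partition_add is_partition_P is_partition_phi_funpow)
qed (simp add: is_partition_P)

lemma tail_chain_sums:
  assumes "\<mu> \<in> P" "\<kappa> \<in> chain_sums L S N \<mu>"
  shows "tail S \<kappa> = \<mu>"
proof (cases N)
  case 0
  then show ?thesis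
    using assms parts_le by (simp add: tail_def filter_mset_eq_conv)
next
  case (Suc M)
  then obtain \<nu> \<kappa>' where "\<nu> \<in> L \<mu>" "\<kappa>' \<in> chain_sums L S M \<nu>" "\<kappa> = \<mu> + (phi ^^ S) \<kappa>'"
    using assms(2) by (auto simp: chain_sums_Suc)
  then show ?thesis
    using assms(1) L_subset parts_le is_partition_chain_sums
    by (metis subsetD tail_add_phi_funpow)
qed

lemma chain_sums_disjoint:
  "\<mu> \<in> P \<Longrightarrow> \<nu> \<in> P \<Longrightarrow> \<mu> \<noteq> \<nu> \<Longrightarrow> chain_sums L S N \<mu> \<inter> chain_sums L S N \<nu> = {}"
  using tail_chain_sums by blast

lemma incseq_chain_sums: "\<mu> \<in> P \<Longrightarrow> incseq (\<lambda>N. chain_sums L S N \<mu>)"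
proof (rule incseq_SucI)
  show "\<mu> \<in> P \<Longrightarrow> chain_sums L S N \<mu> \<subseteq> chain_sums L S (Suc N) \<mu>" for N
  proof (induction N arbitrary: \<mu>)
    case 0
    show ?case
      using empty_mem_L[OF 0] by (force simp: chain_sums_Suc phi_funpow)
  next
    case (Suc N)
    then have "chain_sums L S N \<nu> \<subseteq> chain_sums L S (Suc N) \<nu>" if "\<nu> \<in> L \<mu>" for \<nu>
      using that L_subset by blast
    then show ?case
      unfolding chain_sums_Suc[of L S N \<mu>] chain_sums_Suc[of L S "Suc N" \<mu>]
      by (intro UN_mono image_mono) auto
  qed
qed

lemma ideal_with_tail_eq_UN_chain_sums:
  assumes "\<mu> \<in> P"
  shows "ideal_with_tail P L S \<mu> = (\<Union>N. chain_sums L S N \<mu>)"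
  unfolding ideal_with_tail_def span_one_ideal_eq_UN_chain_sums[OF empty_mem_P]
  using assms tail_chain_sums by auto

lemma gen_fun_chain_sums_Suc:
  assumes "\<mu> \<in> P"
  shows "gen_fun (chain_sums L S (Suc N) \<mu>) q x =
    weight q x \<mu> * (\<Sum>\<nu>\<in>L \<mu>. gen_fun (chain_sums L S N \<nu>) q (x * q ^ S))"
proof -
  define prepend where "prepend = (\<lambda>\<kappa>. \<mu> + (phi ^^ S) \<kappa>)"
  have inj_prepend: "inj prepend"
    using inj_phi_funpow[of S] by (auto simp: prepend_def inj_def)
  have L_mem: "\<nu> \<in> P" if "\<nu> \<in> L \<mu>" for \<nu>
    using that L_subset[OF assms] by blast
  have "sum (weight q x) (chain_sums L S (Suc N) \<mu>) =
      sum (weight q x) (\<Union>\<nu>\<in>L \<mu>. prepend ` chain_sums L S N \<nu>)"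
    by (simp add: chain_sums_Suc prepend_def)
  also have "\<dots> = (\<Sum>\<nu>\<in>L \<mu>. sum (weight q x) (prepend ` chain_sums L S N \<nu>))"
    by (intro sum.UNION_disjoint)
      (use assms L_mem in \<open>auto simp: finite_L finite_chain_sums chain_sums_disjoint
        image_Int[OF inj_prepend, symmetric]\<close>)
  also have "\<dots> = (\<Sum>\<nu>\<in>L \<mu>. \<Sum>\<kappa>\<in>chain_sums L S N \<nu>. weight q x (prepend \<kappa>))"
    using inj_prepend by (simp add: sum.reindex inj_on_subset[of prepend UNIV])
  also have "\<dots> = weight q x \<mu> * (\<Sum>\<nu>\<in>L \<mu>. sum (weight q (x * q ^ S)) (chain_sums L S N \<nu>))"
    by (simp add: prepend_def weight_add weight_phi_funpow sum_distrib_left)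
  finally show ?thesis
    using assms L_mem by (simp add: gen_fun_finite finite_chain_sums)
qed

lemma weight_summable_on_ideal_with_tail:
  assumes "norm q < 1" "norm (x * q) < 1" "\<mu> \<in> P"
  shows "weight q x summable_on ideal_with_tail P L S \<mu>"
proof -
  have "ideal_with_tail P L S \<mu> \<subseteq> {\<kappa>. is_partition \<kappa>}"
    using assms(3) is_partition_chain_sums by (auto simp: ideal_with_tail_eq_UN_chain_sums)
  then show ?thesis
    using norm_weight_summable_on_partitions[OF assms(1,2)]
    by (blast intro: summable_on_subset_banach abs_summable_summable)
qed

lemma gen_fun_chain_sums_LIMSEQ:
  assumes "norm q < 1" "norm (x * q) < 1" "\<mu> \<in> P"
  shows "(\<lambda>N. gen_fun (chain_sums L S N \<mu>) q x) \<longlonglongrightarrow> gen_fun (ideal_with_tail P L S \<mu>) q x"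
proof -
  have "(weight q x has_sum gen_fun (ideal_with_tail P L S \<mu>) q x) (\<Union>N. chain_sums L S N \<mu>)"
    using has_sum_infsum[OF weight_summable_on_ideal_with_tail[OF assms]] assms(3)
    by (simp add: gen_fun_def ideal_with_tail_eq_UN_chain_sums)
  then show ?thesis
    using assms(3)
    by (auto simp: gen_fun_finite finite_chain_sums intro: has_sum_incseq_LIMSEQ incseq_chain_sums)
qed

end


section \<open>The matrix product\<close>

lemma matrix_vector_mult_axis_nth:
  fixes B :: "'a::semiring_1 ^ 'n ^ 'm"
  shows "(B *v axis k 1) $ i = B $ i $ k"
  by (simp add: matrix_vector_mult_def axis_def if_distrib[of "\<lambda>a. _ * a"] cong: if_cong)

lemma weight_matrix_mult_vec: "weight_matrix \<pi> q x *v v = (\<chi> i. weight q x (\<pi> i) * v $ i)"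
  by (simp add: vec_eq_iff matrix_vector_mult_def weight_matrix_def if_distrib[of "\<lambda>a. a * _"]
      cong: if_cong)

lemma weight_matrix_mult_axis:
  "\<pi> k = {#} \<Longrightarrow> weight_matrix \<pi> q x *v axis k 1 = axis k 1"
  by (auto simp: weight_matrix_mult_vec vec_eq_iff axis_def)

lemma link_product_Suc_left:
  "link_product \<pi> L S q x (Suc M) =
     link_matrix \<pi> L ** (weight_matrix \<pi> q (x * q ^ S) ** link_product \<pi> L S q (x * q ^ S) M)"
proof (induction M)
  case 0
  show ?case by simp
next
  case (Suc M)
  have "x * q ^ (Suc (Suc M) * S) = x * q ^ S * q ^ (Suc M * S)"
    by (simp add: power_add mult_ac)
  then show ?case
    unfolding link_product.simps(2)[of _ _ _ _ _ "Suc M"] Suc.IH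
    by (simp only: matrix_mul_assoc link_product.simps(2))
qed

lemma link_product_Suc_component:
  "link_product \<pi> L S q x (Suc M) $ i $ j =
     (\<Sum>l\<in>UNIV. link_product \<pi> L S q x M $ i $ l * link_matrix \<pi> L $ l $ j) *
       weight q (x * q ^ (Suc M * S)) (\<pi> j)"
proof -
  have weight_column: "(B ** weight_matrix \<pi> q y) $ i $ j = B $ i $ j * weight q y (\<pi> j)" for B y
    by (simp add: matrix_matrix_mult_def weight_matrix_def if_distrib[of "\<lambda>a. _ * a"] cong: if_cong)
  show ?thesis
    by (simp add: matrix_mul_assoc weight_column del: mult_Suc) (simp add: matrix_matrix_mult_def)
qed

lemma norm_link_product_le:
  fixes \<pi> :: "'k::finite \<Rightarrow> nat multiset"
  shows "norm (link_product \<pi> L S q x M $ i $ j) \<le>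
     Re (link_product \<pi> L S (of_real (norm q)) (of_real (norm x)) M $ i $ j)"
proof (induction M arbitrary: j)
  case 0
  show ?case by (simp add: mat_def)
next
  case (Suc M)
  let ?q = "of_real (norm q) :: complex" and ?x = "of_real (norm x) :: complex"
  define linked :: "'k \<Rightarrow> real" where "linked l = of_bool (\<pi> j \<in> L (\<pi> l))" for l
  have link_eq: "link_matrix \<pi> L $ l $ j = of_real (linked l)" for l
    by (simp add: link_matrix_def linked_def)
  define w where "w = weight q (x * q ^ (Suc M * S)) (\<pi> j)"
  have weight_eq: "weight ?q (?x * ?q ^ (Suc M * S)) (\<pi> j) = of_real (norm w)"
    using weight_of_real_norm[of q "x * q ^ (Suc M * S)" "\<pi> j"]
    by (simp add: w_def norm_mult norm_power)
  have component: "link_product \<pi> L S s y (Suc M) $ i $ j =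
      (\<Sum>l\<in>UNIV. link_product \<pi> L S s y M $ i $ l * of_real (linked l)) *
        weight s (y * s ^ (Suc M * S)) (\<pi> j)" for s y
    unfolding link_product_Suc_component link_eq ..
  have "norm (link_product \<pi> L S q x (Suc M) $ i $ j) \<le>
      (\<Sum>l\<in>UNIV. norm (link_product \<pi> L S q x M $ i $ l * of_real (linked l))) * norm w"
    unfolding component w_def[symmetric] norm_mult[of _ w]
    by (intro mult_right_mono norm_sum norm_ge_zero)
  also have "\<dots> \<le> (\<Sum>l\<in>UNIV. Re (link_product \<pi> L S ?q ?x M $ i $ l) * linked l) * norm w"
    using Suc.IH by (intro mult_right_mono sum_mono) (auto simp: norm_mult linked_def)
  also have "\<dots> = Re (link_product \<pi> L S ?q ?x (Suc M) $ i $ j)"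
    unfolding component weight_eq by simp
  finally show ?case .
qed

locale enumerated_linked_partitions = linked_partitions P L S
  for P L S +
  fixes \<pi> :: "'k::finite \<Rightarrow> nat multiset" and one :: 'k
  assumes inj_enum: "inj \<pi>" and P_eq_range: "P = range \<pi>" and enum_one: "\<pi> one = {#}"
begin

abbreviation "\<A> \<equiv> link_matrix \<pi> L"
abbreviation "\<W> \<equiv> weight_matrix \<pi>"
abbreviation "\<R> \<equiv> link_product \<pi> L S"

definition gen_vec :: "complex \<Rightarrow> complex \<Rightarrow> complex ^ 'k" where
  "gen_vec q x = (\<chi> k. gen_fun (ideal_with_tail P L S (\<pi> k)) q x)"

definition chain_vec :: "complex \<Rightarrow> complex \<Rightarrow> nat \<Rightarrow> complex ^ 'k" where
  "chain_vec q x N = (\<chi> k. gen_fun (chain_sums L S N (\<pi> k)) q x)"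

lemma enum_mem: "\<pi> k \<in> P"
  by (simp add: P_eq_range)

lemma link_matrix_mult_vec: "\<A> *v (\<chi> k. f (\<pi> k)) = (\<chi> k. \<Sum>\<nu>\<in>L (\<pi> k). f \<nu>)"
proof -
  have "(\<Sum>\<nu>\<in>L (\<pi> k). f \<nu>) = (\<Sum>j\<in>UNIV. \<A> $ k $ j * f (\<pi> j))" for k
  proof -
    have "(\<Sum>\<nu>\<in>L (\<pi> k). f \<nu>) = (\<Sum>\<nu>\<in>P. if \<nu> \<in> L (\<pi> k) then f \<nu> else 0)"
      using L_subset[OF enum_mem] finite_P by (simp add: sum.inter_restrict[symmetric] Int_absorb1)
    also have "\<dots> = (\<Sum>j\<in>UNIV. \<A> $ k $ j * f (\<pi> j))"
      unfolding P_eq_range sum.reindex[OF inj_enum] by (intro sum.cong) (auto simp: link_matrix_def)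
    finally show ?thesis .
  qed
  then show ?thesis
    by (simp add: matrix_vector_mult_def)
qed

lemma link_matrix_mult_axis: "\<A> *v axis one 1 = 1"
  using empty_mem_L[OF enum_mem]
  by (simp add: vec_eq_iff matrix_vector_mult_axis_nth link_matrix_def enum_one)

lemma chain_vec_Suc: "chain_vec q x (Suc M) = \<W> q x *v (\<A> *v chain_vec q (x * q ^ S) M)"
  unfolding chain_vec_def weight_matrix_mult_vec
    link_matrix_mult_vec[of "\<lambda>\<nu>. gen_fun (chain_sums L S M \<nu>) q (x * q ^ S)"]
  by (simp add: gen_fun_chain_sums_Suc enum_mem)

lemma chain_vec_eq_link_product: "chain_vec q x M = \<W> q x *v (\<R> q x M *v 1)"
proof (induction M arbitrary: x)
  case 0
  show ?case
    by (simp add: chain_vec_def weight_matrix_mult_vec gen_fun_finite vec_eq_iff)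
next
  case (Suc M)
  show ?case
    unfolding chain_vec_Suc Suc.IH link_product_Suc_left by (simp only: matrix_vector_mul_assoc)
qed

lemma link_product_Suc_mult_one: "\<R> q x (Suc M) *v 1 = \<A> *v chain_vec q (x * q ^ S) M"
  unfolding chain_vec_eq_link_product link_product_Suc_left by (simp only: matrix_vector_mul_assoc)

lemma link_product_Suc_mult_axis: "\<R> q x (Suc M) *v axis one 1 = \<R> q x M *v 1"
  by (simp add: matrix_vector_mul_assoc[symmetric] weight_matrix_mult_axis enum_one
      link_matrix_mult_axis)

lemma chain_vec_LIMSEQ:
  assumes "norm q < 1" "norm (x * q) < 1"
  shows "chain_vec q x \<longlonglongrightarrow> gen_vec q x"
  by (rule vec_tendstoI)
    (simp add: chain_vec_def gen_vec_def gen_fun_chain_sums_LIMSEQ assms enum_mem)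

lemma link_matrix_mult_chain_vec_LIMSEQ:
  assumes "norm q < 1" "norm (x * q) < 1"
  shows "(\<lambda>M. \<A> *v chain_vec q (x * q ^ S) M) \<longlonglongrightarrow> \<A> *v gen_vec q (x * q ^ S)"
proof (intro isCont_tendsto_compose[OF matrix_vector_mult_linear_continuous_at] chain_vec_LIMSEQ)
  have "norm (x * q ^ S * q) = norm (x * q) * norm q ^ S"
    by (simp add: norm_mult norm_power)
  also have "\<dots> \<le> norm (x * q)"
    using assms(1) by (intro mult_left_le power_le_one) auto
  finally show "norm (x * q ^ S * q) < 1"
    using assms(2) by simp
qed (fact assms)

lemma gen_vec_functional_equation:
  assumes "norm q < 1" "norm (x * q) < 1"
  shows "gen_vec q x = \<W> q x *v (\<A> *v gen_vec q (x * q ^ S))"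
proof (rule LIMSEQ_unique)
  show "(\<lambda>M. chain_vec q x (Suc M)) \<longlonglongrightarrow> gen_vec q x"
    using assms by (intro LIMSEQ_Suc chain_vec_LIMSEQ)
  show "(\<lambda>M. chain_vec q x (Suc M)) \<longlonglongrightarrow> \<W> q x *v (\<A> *v gen_vec q (x * q ^ S))"
    unfolding chain_vec_Suc using assms
    by (intro isCont_tendsto_compose[OF matrix_vector_mult_linear_continuous_at]
        link_matrix_mult_chain_vec_LIMSEQ)
qed

lemma link_product_mult_axis_LIMSEQ:
  assumes "norm q < 1" "norm (x * q) < 1"
  shows "(\<lambda>M. \<R> q x M *v axis one 1) \<longlonglongrightarrow> \<A> *v gen_vec q (x * q ^ S)"
proof (rule LIMSEQ_imp_Suc, rule LIMSEQ_imp_Suc)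
  show "(\<lambda>M. \<R> q x (Suc (Suc M)) *v axis one 1) \<longlonglongrightarrow> \<A> *v gen_vec q (x * q ^ S)"
    unfolding link_product_Suc_mult_axis link_product_Suc_mult_one
    using assms by (rule link_matrix_mult_chain_vec_LIMSEQ)
qed

lemma norm_link_product_nonempty_column_le:
  fixes q x :: complex
  defines "majorant \<equiv> \<R> (of_real (norm q)) (of_real (norm x))"
  assumes "j \<noteq> one"
  shows "norm (\<R> q x M $ i $ j) \<le>
    Re ((majorant (Suc M) *v axis one 1 - majorant M *v axis one 1) $ i)"
proof -
  have "norm (\<R> q x M $ i $ j) \<le> Re (majorant M $ i $ j)"
    unfolding majorant_def by (rule norm_link_product_le)
  also have "\<dots> \<le> (\<Sum>l\<in>UNIV - {one}. Re (majorant M $ i $ l))"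
    using assms(2) order_trans[OF norm_ge_zero norm_link_product_le]
    by (intro member_le_sum) (auto simp: majorant_def)
  also have "\<dots> = (\<Sum>l\<in>UNIV. Re (majorant M $ i $ l)) - Re (majorant M $ i $ one)"
    by (simp add: sum_diff1)
  also have "\<dots> = Re ((majorant M *v 1 - majorant M *v axis one 1) $ i)"
    by (simp add: matrix_vector_mult_axis_nth) (simp add: matrix_vector_mult_def)
  finally show ?thesis
    unfolding majorant_def link_product_Suc_mult_axis .
qed

lemma link_product_nonempty_column_LIMSEQ:
  assumes "norm q < 1" "norm (x * q) < 1" "j \<noteq> one"
  shows "(\<lambda>M. \<R> q x M $ i $ j) \<longlonglongrightarrow> 0"
proof (rule Lim_null_comparison)
  define majorant where "majorant = \<R> (of_real (norm q)) (of_real (norm x))"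
  have "(\<lambda>M. majorant M *v axis one 1) \<longlonglongrightarrow>
      \<A> *v gen_vec (of_real (norm q)) (of_real (norm x) * of_real (norm q) ^ S)"
    unfolding majorant_def using assms(1,2)
    by (intro link_product_mult_axis_LIMSEQ) (simp_all add: norm_mult)
  from tendsto_diff[OF LIMSEQ_Suc[OF this] this]
  have "(\<lambda>M. majorant (Suc M) *v axis one 1 - majorant M *v axis one 1) \<longlonglongrightarrow> 0"
    by simp
  from tendsto_Re[OF tendsto_vec_nth[OF this, of i]]
  show "(\<lambda>M. Re ((majorant (Suc M) *v axis one 1 - majorant M *v axis one 1) $ i)) \<longlonglongrightarrow> 0"
    by simp
  show "\<forall>\<^sub>F M in sequentially. norm (\<R> q x M $ i $ j) \<le>
      Re ((majorant (Suc M) *v axis one 1 - majorant M *v axis one 1) $ i)"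
    unfolding majorant_def using assms(3)
    by (intro always_eventually allI norm_link_product_nonempty_column_le)
qed

lemma link_product_LIMSEQ:
  assumes "norm q < 1" "norm (x * q) < 1"
  shows "\<R> q x \<longlonglongrightarrow> (\<chi> i j. if j = one then (\<A> *v gen_vec q (x * q ^ S)) $ i else 0)"
proof (intro vec_tendstoI)
  fix i j
  show "(\<lambda>M. \<R> q x M $ i $ j) \<longlonglongrightarrow>
      (\<chi> i j. if j = one then (\<A> *v gen_vec q (x * q ^ S)) $ i else 0) $ i $ j"
  proof (cases "j = one")
    case True
    then show ?thesis
      using tendsto_vec_nth[OF link_product_mult_axis_LIMSEQ[OF assms], of i]
      by (simp add: matrix_vector_mult_axis_nth)
  next
    case False
    then show ?thesis
      using link_product_nonempty_column_LIMSEQ[OF assms] by simp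
  qed
qed

end

theorem theorem1p1:
  fixes P :: "nat multiset set"
    and \<pi> :: "'k::finite \<Rightarrow> nat multiset"
    and one :: 'k
    and L :: "nat multiset \<Rightarrow> nat multiset set"
    and S :: nat
    and q x :: complex
  assumes "inj \<pi>" and "P = range \<pi>"
    and "\<forall>\<mu>\<in>P. is_partition \<mu>"
    and "\<pi> one = {#}"
    and "\<forall>k. L (\<pi> k) \<subseteq> P"
    and "\<forall>k. {#} \<in> L (\<pi> k)"
    and "L {#} = P"
    and "0 < S"
    and "\<forall>\<mu>\<in>P. \<forall>p\<in>#\<mu>. p \<le> S"
    and "norm q < 1"
    and "q \<noteq> 0 \<longrightarrow> norm x < inverse (norm q)"
  shows "(\<forall>k. weight q x summable_on ideal_with_tail P L S (\<pi> k)) \<and>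
    convergent (link_product \<pi> L S q x) \<and>
    (\<chi> k. gen_fun (ideal_with_tail P L S (\<pi> k)) q x) =
      (weight_matrix \<pi> q x ** lim (link_product \<pi> L S q x)) *v axis one 1"
proof -
  interpret enumerated_linked_partitions P L S \<pi> one
    using assms by unfold_locales (auto intro: range_eqI[of _ \<pi> one])
  have norm_xq: "norm (x * q) < 1"
    using \<open>q \<noteq> 0 \<longrightarrow> norm x < inverse (norm q)\<close>
    by (cases "q = 0") (auto simp: norm_mult field_simps)
  note limit = link_product_LIMSEQ[OF \<open>norm q < 1\<close> norm_xq]
  have "lim (\<R> q x) *v axis one 1 = \<A> *v gen_vec q (x * q ^ S)"
    by (simp add: limI[OF limit] vec_eq_iff matrix_vector_mult_axis_nth)
  then have "gen_vec q x = (\<W> q x ** lim (\<R> q x)) *v axis one 1"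
    using gen_vec_functional_equation[OF \<open>norm q < 1\<close> norm_xq]
    by (simp add: matrix_vector_mul_assoc[symmetric])
  then show ?thesis
    using weight_summable_on_ideal_with_tail[OF \<open>norm q < 1\<close> norm_xq enum_mem] limit
    by (auto simp: gen_vec_def convergent_def)
qed

end
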